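(* Let $(M,\omega)$ be a closed symplectic manifold and $\mathbb{A}$ a finite-dimensional Poisson-commutative subspace of $C^{\infty}(M)$, with moment map $\Phi\colon M\to\mathbb{A}^{\ast}$. Let $\zeta\colon C(M)\to\mathbb{R}$ be a partial symplectic quasi-state on $(M,\omega)$. Then there exists $y_0\in\Phi(M)$ such that $\Phi^{-1}(y_0)$ is $\zeta$-pseudoheavy.
   Context: $C(M)$ (resp. $C^\infty(M)$) is the set of continuous (resp. smooth) real-valued functions on $M$. A subspace $\mathbb{A}\subset C^\infty(M)$ is Poisson-commutative if $\{F,G\}=0$ for all $F,G\in\mathbb{A}$; its moment map $\Phi\colon M\to\mathbb{A}^\ast$ is given by $F(x)=\langle\Phi(x),F\rangle$ for $x\in M$, $F\in\mathbb{A}$. For a (smooth) Hamiltonian $H\colon S^1\times M\to\mathbb{R}$ ($S^1=\mathbb{R}/\mathbb{Z}$, $H_t=H(t,\cdot)$), the Hamiltonian vector field is defined by $\iota_{X_{H_t}}\omega=-dH_t$, and $\varphi_H$ is the time-1 map of its flow; $\mathrm{Ham}(M,\omega)$ is the group of all such $\varphi_H$. A subset $X\subset M$ is displaceable from $Y\subset M$ if there is $H$ with $\varphi_H(X)\cap\overline{Y}=\emptyset$. A partial symplectic quasi-state on $(M,\omega)$ is a functional $\zeta\colon C(M)\to\mathbb{R}$ such that: (Normalization) $\zeta(a)=a$ for every constant function $a$; (Stability) $\min_M(H_1-H_2)\le\zeta(H_1)-\zeta(H_2)\le\max_M(H_1-H_2)$ for all $H_1,H_2\in C(M)$; (Semi-homogeneity)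 $\zeta(sH)=s\zeta(H)$ for all $H\in C(M)$, $s>0$; (Hamiltonian invariance) $\zeta(H\circ\phi)=\zeta(H)$ for all $H\in C(M)$, $\phi\in\mathrm{Ham}(M,\omega)$; (Vanishing) $\zeta(H)=0$ for every $H\in C(M)$ whose support is displaceable from itself; (Quasi-subadditivity) $\zeta(H_1+H_2)\le\zeta(H_1)+\zeta(H_2)$ for all $H_1,H_2\in C^\infty(M)$ with $\{H_1,H_2\}=0$. For an open $U\subset M$, $\mathcal{H}(U)$ is the set of functions in $C(M)$ whose support is contained in $U$. A closed subset $X\subset M$ is $\zeta$-pseudoheavy if for every open neighborhood $U$ of $X$ there exists $F\in\mathcal{H}(U)$ with $\zeta(F)>0$. *)

theory Defs
  imports "HOL-Analysis.Analysis" "HOL-Library.Function_Algebras"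
begin

section \<open>Smooth maps between open subsets of normed vector spaces\<close>

text \<open>Both notions are only used for open \<open>S\<close>; the model spaces are finite-dimensional.\<close>

primrec Ck_on :: "nat \<Rightarrow> 'a::real_normed_vector set \<Rightarrow> ('a \<Rightarrow> 'b::real_normed_vector) \<Rightarrow> bool" where
  "Ck_on 0 S f \<longleftrightarrow> continuous_on S f"
| "Ck_on (Suc k) S f \<longleftrightarrow> (\<forall>x\<in>S. f differentiable (at x)) \<and>
     (\<forall>v. Ck_on k S (\<lambda>x. frechet_derivative f (at x) v))"

definition smooth_on :: "'a::real_normed_vector set \<Rightarrow> ('a \<Rightarrow> 'b::real_normed_vector) \<Rightarrow> bool" where
  "smooth_on S f \<longleftrightarrow> (\<forall>k. Ck_on k S f)"


section \<open>Smooth manifolds\<close>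

text \<open>The manifold \<open>M\<close> is the whole type \<open>'m\<close>.  A chart is an open set together with a map to
  the model space that is a homeomorphism from that set onto an open set; the values of the map
  outside the chart domain are irrelevant.\<close>

type_synonym ('m, 'e) chart = "'m set \<times> ('m \<Rightarrow> 'e)"

abbreviation chart_dom :: "('m, 'e) chart \<Rightarrow> 'm set" where
  "chart_dom c \<equiv> fst c"

abbreviation chart_map :: "('m, 'e) chart \<Rightarrow> 'm \<Rightarrow> 'e" where
  "chart_map c \<equiv> snd c"

definition chart_inv :: "('m, 'e) chart \<Rightarrow> 'e \<Rightarrow> 'm" where
  "chart_inv c = inv_into (chart_dom c) (chart_map c)"

definition chart_codom :: "('m, 'e) chart \<Rightarrow> 'e set" where
  "chart_codom c = chart_map c ` chart_dom c"

definition is_chart :: "('m::topological_space, 'e::real_normed_vector) chart \<Rightarrow> bool" where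
  "is_chart c \<longleftrightarrow> open (chart_dom c) \<and> open (chart_codom c) \<and>
     homeomorphism (chart_dom c) (chart_codom c) (chart_map c) (chart_inv c)"

definition smooth_atlas :: "('m::topological_space, 'e::real_normed_vector) chart set \<Rightarrow> bool" where
  "smooth_atlas \<A> \<longleftrightarrow>
     (\<forall>c\<in>\<A>. is_chart c) \<and> (\<Union>c\<in>\<A>. chart_dom c) = UNIV \<and>
     (\<forall>c\<in>\<A>. \<forall>d\<in>\<A>. smooth_on (chart_map c ` (chart_dom c \<inter> chart_dom d))
        (chart_map d \<circ> chart_inv c))"

text \<open>The model space is a finite-dimensional normed space rather than a type of class
  \<open>euclidean_space\<close>, because the latter always has positive dimension.\<close>

definition closed_manifold ::
    "('m::{t2_space,second_countable_topology}, 'e::real_normed_vector) chart set \<Rightarrow> bool" where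
  "closed_manifold \<A> \<longleftrightarrow>
     (\<exists>B::'e set. finite B \<and> span B = UNIV) \<and> smooth_atlas \<A> \<and> compact (UNIV :: 'm set)"

definition cont_functions :: "('m::topological_space \<Rightarrow> real) set" where
  "cont_functions = {F. continuous_on UNIV F}"

definition smooth_functions ::
    "('m::topological_space, 'e::real_normed_vector) chart set \<Rightarrow> ('m \<Rightarrow> real) set" where
  "smooth_functions \<A> = {F. \<forall>c\<in>\<A>. smooth_on (chart_codom c) (F \<circ> chart_inv c)}"

text \<open>Pointwise scalar multiplication; addition is pointwise by \<open>Function_Algebras\<close>.\<close>

definition fscale :: "real \<Rightarrow> ('a \<Rightarrow> real) \<Rightarrow> 'a \<Rightarrow> real" where
  "fscale a F = (\<lambda>x. a * F x)"

interpretation fun_vs: vector_space "fscale :: real \<Rightarrow> ('a \<Rightarrow> real) \<Rightarrow> 'a \<Rightarrow> real"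
  by unfold_locales (auto simp: fscale_def fun_eq_iff algebra_simps)


section \<open>Tangent vectors and symplectic forms\<close>

text \<open>A tangent vector is represented by the directional derivative it induces on \<open>C\<^sup>\<infinity>(M)\<close>,
  so that \<open>dF(X) = X F\<close>; it is set to \<open>0\<close> on non-smooth functions, in order that two tangent
  vectors are equal iff they agree on \<open>C\<^sup>\<infinity>(M)\<close>.  The vector \<open>coord_vector \<A> c x v\<close> is the one
  with coordinates \<open>v\<close> in the chart \<open>c\<close> around \<open>x\<close>.\<close>

type_synonym 'm tvector = "('m \<Rightarrow> real) \<Rightarrow> real"

definition coord_vector ::
    "('m::topological_space, 'e::real_normed_vector) chart set \<Rightarrow> ('m, 'e) chart \<Rightarrow> 'm \<Rightarrow> 'e \<Rightarrow> 'm tvector"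
  where
  "coord_vector \<A> c x v = (\<lambda>F. if F \<in> smooth_functions \<A>
     then frechet_derivative (F \<circ> chart_inv c) (at (chart_map c x)) v else 0)"

definition tangent_space ::
    "('m::topological_space, 'e::real_normed_vector) chart set \<Rightarrow> 'm \<Rightarrow> 'm tvector set" where
  "tangent_space \<A> x = {coord_vector \<A> c x v | c v. c \<in> \<A> \<and> x \<in> chart_dom c}"

text \<open>Only the values of \<open>\<omega> x\<close> on the tangent space at \<open>x\<close> are relevant.\<close>

type_synonym 'm form2 = "'m \<Rightarrow> 'm tvector \<Rightarrow> 'm tvector \<Rightarrow> real"

definition coord_form ::
    "('m::topological_space, 'e::real_normed_vector) chart set \<Rightarrow> 'm form2 \<Rightarrow> ('m, 'e) chart \<Rightarrow>
     'e \<Rightarrow> 'e \<Rightarrow> 'e \<Rightarrow> real" where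
  "coord_form \<A> \<omega> c p u v =
     \<omega> (chart_inv c p) (coord_vector \<A> c (chart_inv c p) u) (coord_vector \<A> c (chart_inv c p) v)"

definition differential_2form ::
    "('m::topological_space, 'e::real_normed_vector) chart set \<Rightarrow> 'm form2 \<Rightarrow> bool" where
  "differential_2form \<A> \<omega> \<longleftrightarrow>
     (\<forall>x. \<forall>X\<in>tangent_space \<A> x. \<forall>Y\<in>tangent_space \<A> x. \<forall>Z\<in>tangent_space \<A> x. \<forall>a b.
        \<omega> x (fscale a X + fscale b Y) Z = a * \<omega> x X Z + b * \<omega> x Y Z) \<and>
     (\<forall>x. \<forall>X\<in>tangent_space \<A> x. \<forall>Y\<in>tangent_space \<A> x. \<omega> x X Y = - \<omega> x Y X) \<and>
     (\<forall>c\<in>\<A>. \<forall>u v. smooth_on (chart_codom c) (\<lambda>p. coord_form \<A> \<omega> c p u v))"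

text \<open>The formula \<open>d\<omega>(u,v,w) = u \<omega>(v,w) - v \<omega>(u,w) + w \<omega>(u,v)\<close> for coordinate vector fields
  with constant coefficients, whose Lie brackets vanish.\<close>

definition closed_2form ::
    "('m::topological_space, 'e::real_normed_vector) chart set \<Rightarrow> 'm form2 \<Rightarrow> bool" where
  "closed_2form \<A> \<omega> \<longleftrightarrow> (\<forall>c\<in>\<A>. \<forall>p\<in>chart_codom c. \<forall>u v w.
       frechet_derivative (\<lambda>q. coord_form \<A> \<omega> c q v w) (at p) u
     - frechet_derivative (\<lambda>q. coord_form \<A> \<omega> c q u w) (at p) v
     + frechet_derivative (\<lambda>q. coord_form \<A> \<omega> c q u v) (at p) w = 0)"

definition nondegenerate_2form ::
    "('m::topological_space, 'e::real_normed_vector) chart set \<Rightarrow> 'm form2 \<Rightarrow> bool" where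
  "nondegenerate_2form \<A> \<omega> \<longleftrightarrow> (\<forall>x. \<forall>X\<in>tangent_space \<A> x.
     (\<forall>Y\<in>tangent_space \<A> x. \<omega> x X Y = 0) \<longrightarrow> X = 0)"

definition closed_symplectic_manifold ::
    "('m::{t2_space,second_countable_topology}, 'e::real_normed_vector) chart set \<Rightarrow> 'm form2 \<Rightarrow> bool" where
  "closed_symplectic_manifold \<A> \<omega> \<longleftrightarrow> closed_manifold \<A> \<and>
     differential_2form \<A> \<omega> \<and> closed_2form \<A> \<omega> \<and> nondegenerate_2form \<A> \<omega>"


section \<open>Hamiltonian dynamics\<close>

definition ham_vector_field ::
    "('m::topological_space, 'e::real_normed_vector) chart set \<Rightarrow> 'm form2 \<Rightarrow> ('m \<Rightarrow> real) \<Rightarrow>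
     'm \<Rightarrow> 'm tvector" where
  "ham_vector_field \<A> \<omega> F x =
     (THE X. X \<in> tangent_space \<A> x \<and> (\<forall>Y\<in>tangent_space \<A> x. \<omega> x X Y = - Y F))"

text \<open>With \<open>\<iota>\<^bsub>X\<^esub>\<omega> = -dF\<close>, this is \<open>dF(X\<^bsub>G\<^esub>)\<close>.  The opposite sign convention yields the same
  notion of commuting functions.\<close>

definition poisson_bracket ::
    "('m::topological_space, 'e::real_normed_vector) chart set \<Rightarrow> 'm form2 \<Rightarrow> ('m \<Rightarrow> real) \<Rightarrow>
     ('m \<Rightarrow> real) \<Rightarrow> 'm \<Rightarrow> real" where
  "poisson_bracket \<A> \<omega> F G x = \<omega> x (ham_vector_field \<A> \<omega> G x) (ham_vector_field \<A> \<omega> F x)"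

text \<open>Smooth functions on \<open>S\<^sup>1 \<times> M\<close> are represented by smooth functions on \<open>\<real> \<times> M\<close> that are
  1-periodic in the first variable.\<close>

definition hamiltonian ::
    "('m::topological_space, 'e::real_normed_vector) chart set \<Rightarrow> (real \<Rightarrow> 'm \<Rightarrow> real) \<Rightarrow> bool" where
  "hamiltonian \<A> H \<longleftrightarrow> (\<forall>t x. H (t + 1) x = H t x) \<and>
     (\<forall>c\<in>\<A>. smooth_on (UNIV \<times> chart_codom c) (\<lambda>(t, p). H t (chart_inv c p)))"

text \<open>The second condition says that the velocity of \<open>s \<mapsto> \<phi> s x\<close> at time \<open>t\<close> is the value
  of the Hamiltonian vector field of \<open>H t\<close> at \<open>\<phi> t x\<close>, both regarded as derivations of
  \<open>C\<^sup>\<infinity>(M)\<close>.  On a closed manifold such a flow exists and is unique.\<close>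

definition ham_flow ::
    "('m::topological_space, 'e::real_normed_vector) chart set \<Rightarrow> 'm form2 \<Rightarrow> (real \<Rightarrow> 'm \<Rightarrow> real) \<Rightarrow>
     (real \<Rightarrow> 'm \<Rightarrow> 'm) \<Rightarrow> bool" where
  "ham_flow \<A> \<omega> H \<phi> \<longleftrightarrow> (\<forall>x. \<phi> 0 x = x) \<and>
     (\<forall>x t. \<forall>F\<in>smooth_functions \<A>.
        ((\<lambda>s. F (\<phi> s x)) has_real_derivative ham_vector_field \<A> \<omega> (H t) (\<phi> t x) F) (at t))"

definition Ham ::
    "('m::topological_space, 'e::real_normed_vector) chart set \<Rightarrow> 'm form2 \<Rightarrow> ('m \<Rightarrow> 'm) set" where
  "Ham \<A> \<omega> = {\<phi> 1 | H \<phi>. hamiltonian \<A> H \<and> ham_flow \<A> \<omega> H \<phi>}"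

definition displaceable_from ::
    "('m::topological_space, 'e::real_normed_vector) chart set \<Rightarrow> 'm form2 \<Rightarrow> 'm set \<Rightarrow> 'm set \<Rightarrow> bool"
  where
  "displaceable_from \<A> \<omega> X Y \<longleftrightarrow> (\<exists>\<psi>\<in>Ham \<A> \<omega>. \<psi> ` X \<inter> closure Y = {})"


section \<open>Partial symplectic quasi-states and pseudoheavy sets\<close>

definition fsupport :: "('m::topological_space \<Rightarrow> real) \<Rightarrow> 'm set" where
  "fsupport F = closure {x. F x \<noteq> 0}"

text \<open>Functionals on \<open>C(M)\<close> are total functions whose values outside \<open>C(M)\<close> are irrelevant.
  The infimum and supremum below are a minimum and a maximum, since \<open>M\<close> is compact.\<close>

definition partial_symplectic_quasi_state ::
    "('m::topological_space, 'e::real_normed_vector) chart set \<Rightarrow> 'm form2 \<Rightarrow>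
     (('m \<Rightarrow> real) \<Rightarrow> real) \<Rightarrow> bool" where
  "partial_symplectic_quasi_state \<A> \<omega> \<zeta> \<longleftrightarrow>
     (\<forall>a. \<zeta> (\<lambda>x. a) = a) \<and>
     (\<forall>H1\<in>cont_functions. \<forall>H2\<in>cont_functions.
        (INF x. H1 x - H2 x) \<le> \<zeta> H1 - \<zeta> H2 \<and> \<zeta> H1 - \<zeta> H2 \<le> (SUP x. H1 x - H2 x)) \<and>
     (\<forall>H\<in>cont_functions. \<forall>s>0. \<zeta> (\<lambda>x. s * H x) = s * \<zeta> H) \<and>
     (\<forall>H\<in>cont_functions. \<forall>\<psi>\<in>Ham \<A> \<omega>. \<zeta> (H \<circ> \<psi>) = \<zeta> H) \<and>
     (\<forall>H\<in>cont_functions. displaceable_from \<A> \<omega> (fsupport H) (fsupport H) \<longrightarrow> \<zeta> H = 0) \<and>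
     (\<forall>H1\<in>smooth_functions \<A>. \<forall>H2\<in>smooth_functions \<A>.
        (\<forall>x. poisson_bracket \<A> \<omega> H1 H2 x = 0) \<longrightarrow> \<zeta> (\<lambda>x. H1 x + H2 x) \<le> \<zeta> H1 + \<zeta> H2)"

definition functions_supported_in :: "'m::topological_space set \<Rightarrow> ('m \<Rightarrow> real) set" where
  "functions_supported_in U = {F \<in> cont_functions. fsupport F \<subseteq> U}"

definition pseudoheavy :: "(('m::topological_space \<Rightarrow> real) \<Rightarrow> real) \<Rightarrow> 'm set \<Rightarrow> bool" where
  "pseudoheavy \<zeta> X \<longleftrightarrow> closed X \<and>
     (\<forall>U. open U \<and> X \<subseteq> U \<longrightarrow> (\<exists>F\<in>functions_supported_in U. \<zeta> F > 0))"


section \<open>Poisson-commutative subspaces and moment maps\<close>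

definition finite_dim_subspace :: "('m \<Rightarrow> real) set \<Rightarrow> bool" where
  "finite_dim_subspace A \<longleftrightarrow> fun_vs.subspace A \<and> (\<exists>B. finite B \<and> fun_vs.span B = A)"

definition poisson_commutative ::
    "('m::topological_space, 'e::real_normed_vector) chart set \<Rightarrow> 'm form2 \<Rightarrow> ('m \<Rightarrow> real) set \<Rightarrow> bool"
  where
  "poisson_commutative \<A> \<omega> A \<longleftrightarrow> (\<forall>F\<in>A. \<forall>G\<in>A. \<forall>x. poisson_bracket \<A> \<omega> F G x = 0)"

text \<open>Functionals on a subspace \<open>A\<close> are normalised to be \<open>undefined\<close> outside \<open>A\<close>, so that they
  are equal iff they agree on \<open>A\<close>.\<close>

definition dual_space :: "('m \<Rightarrow> real) set \<Rightarrow> (('m \<Rightarrow> real) \<Rightarrow> real) set" where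
  "dual_space A = {l \<in> extensional A.
     \<forall>F\<in>A. \<forall>G\<in>A. \<forall>a b. l (fscale a F + fscale b G) = a * l F + b * l G}"

definition moment_map :: "('m \<Rightarrow> real) set \<Rightarrow> 'm \<Rightarrow> (('m \<Rightarrow> real) \<Rightarrow> real)" where
  "moment_map A x = (\<lambda>F\<in>A. F x)"

lemma moment_map_in_dual_space:
  assumes "fun_vs.subspace A"
  shows "moment_map A x \<in> dual_space A"
proof -
  have "fscale a F + fscale b G \<in> A" if "F \<in> A" "G \<in> A" for a b F G
    using that assms by (simp add: fun_vs.subspace_add fun_vs.subspace_scale)
  then show ?thesis
    by (auto simp: moment_map_def dual_space_def fscale_def)
qed

end

theory Submission
  imports Defs
begin

text \<open>
  The theorem is a compactness argument.  If no fibre of the moment map \<open>\<Phi>\<close> is pseudoheavy, every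
  fibre has a neighbourhood \<open>U\<close> such that \<open>\<zeta>\<close> is nonpositive on all functions supported in \<open>U\<close>.
  Put into each such \<open>U\<close> a nonnegative bump function that factors through \<open>\<Phi>\<close> and is positive on
  the fibre (\<open>fibre_bump\<close>).  Finitely many of these bumps have a sum \<open>s\<close> with a positive minimum \<open>m\<close>,
  whence \<open>\<zeta> s \<ge> m > 0\<close> by stability and normalization.  All the bumps are functions of \<open>\<Phi>\<close> and so
  should Poisson-commute, and then subadditivity gives \<open>\<zeta> s \<le> 0\<close>, a contradiction.

  Subadditivity is an axiom for smooth commuting functions only.  Instead of smooth cutoff
  functions on the dual space and the chain rule for Poisson brackets, the proof uses polynomials.
  By the Leibniz rule the polynomials in elements of \<open>A\<close> form a Poisson-commutative algebra
  (\<open>generated_algebra_poisson_commutative\<close>); since \<open>\<zeta>\<close> is 1-Lipschitz for the supremum norm,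
  subadditivity passes to uniform limits of such polynomials
  (\<open>quasi_state_subadditive_uniform_closure\<close>).  A bump can then be merely continuous: it is
  \<open>max 0 (e - D)\<close> for a polynomial \<open>D\<close> vanishing exactly on the fibre, and the Weierstrass
  theorem in one real variable approximates it.

  The Leibniz rule needs Hamiltonian vector fields to exist and to be unique, as they are
  introduced by a definite description.  Uniqueness is nondegeneracy of \<open>\<omega>\<close>; existence is
  linear algebra in one chart (\<open>hamiltonian_vector_exists\<close>).
\<close>

section \<open>Smooth functions form an algebra\<close>

lemma frechet_derivative_cong_open:
  assumes "open S" "x \<in> S" "\<And>y. y \<in> S \<Longrightarrow> f y = g y"
  shows "frechet_derivative f (at x) = frechet_derivative g (at x)"
proof -
  have "(f has_derivative D) (at x) = (g has_derivative D) (at x)" for D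
    using assms by (metis has_derivative_transform_within_open)
  then show ?thesis unfolding frechet_derivative_def by simp
qed

lemma Ck_on_cong:
  assumes "open S" "\<And>y. y \<in> S \<Longrightarrow> f y = g y" "Ck_on k S f"
  shows "Ck_on k S g"
  using assms
proof (induction k arbitrary: f g)
  case 0
  then show ?case by (auto cong: continuous_on_cong)
next
  case (Suc k)
  have "g differentiable at x" if "x \<in> S" for x
  proof -
    have "(f has_derivative frechet_derivative f (at x)) (at x)"
      using Suc.prems(3) that by (simp add: frechet_derivative_works)
    then have "(g has_derivative frechet_derivative f (at x)) (at x)"
      by (rule has_derivative_transform_within_open[OF _ Suc.prems(1) that])
        (rule Suc.prems(2))
    then show ?thesis by (rule differentiableI)
  qed
  moreover have "Ck_on k S (\<lambda>x. frechet_derivative g (at x) v)" for v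
    by (rule Suc.IH[of "\<lambda>x. frechet_derivative f (at x) v"])
      (use Suc.prems frechet_derivative_cong_open[of S _ f g] in auto)
  ultimately show ?case by simp
qed

lemma Ck_on_Suc_imp_Ck_on: "Ck_on (Suc k) S f \<Longrightarrow> Ck_on k S f"
proof (induction k arbitrary: f)
  case 0
  then show ?case
    by (auto intro!: differentiable_imp_continuous_on differentiable_at_imp_differentiable_on)
next
  case (Suc k)
  show ?case
    unfolding Ck_on.simps(2)[of k]
  proof (intro conjI allI)
    show "\<forall>x\<in>S. f differentiable at x" using Suc.prems unfolding Ck_on.simps(2)[of "Suc k"] by blast
    fix v
    have "Ck_on (Suc k) S (\<lambda>x. frechet_derivative f (at x) v)"
      using Suc.prems unfolding Ck_on.simps(2)[of "Suc k"] by blast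
    then show "Ck_on k S (\<lambda>x. frechet_derivative f (at x) v)" by (rule Suc.IH)
  qed
qed

lemma Ck_on_const: "Ck_on k S (\<lambda>x. a)"
  by (induction k arbitrary: a) auto

lemma frechet_derivative_add:
  assumes "f differentiable at x" "g differentiable at x"
  shows "frechet_derivative (\<lambda>x. f x + g x) (at x) =
     (\<lambda>v. frechet_derivative f (at x) v + frechet_derivative g (at x) v)"
  using assms unfolding frechet_derivative_works
  by (intro frechet_derivative_at[symmetric] has_derivative_add)

lemma Ck_on_add:
  assumes "open S" "Ck_on k S f" "Ck_on k S g"
  shows "Ck_on k S (\<lambda>x. f x + g x)"
  using assms(2,3)
proof (induction k arbitrary: f g)
  case 0
  then show ?case by (auto intro: continuous_on_add)
next
  case (Suc k)
  have "Ck_on k S (\<lambda>x. frechet_derivative (\<lambda>x. f x + g x) (at x) v)" for v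
    by (rule Ck_on_cong[OF \<open>open S\<close> _ Suc.IH[of "\<lambda>x. frechet_derivative f (at x) v"
            "\<lambda>x. frechet_derivative g (at x) v"]])
      (use Suc.prems in \<open>auto simp: frechet_derivative_add\<close>)
  then show ?case using Suc.prems by auto
qed

lemma frechet_derivative_real_mult:
  fixes f g :: "'a::real_normed_vector \<Rightarrow> real"
  assumes "f differentiable at x" "g differentiable at x"
  shows "frechet_derivative (\<lambda>x. f x * g x) (at x) =
     (\<lambda>v. f x * frechet_derivative g (at x) v + frechet_derivative f (at x) v * g x)"
  using assms unfolding frechet_derivative_works
  by (intro frechet_derivative_at[symmetric] has_derivative_mult)

lemma Ck_on_mult:
  fixes f g :: "'a::real_normed_vector \<Rightarrow> real"
  assumes "open S" "Ck_on k S f" "Ck_on k S g"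
  shows "Ck_on k S (\<lambda>x. f x * g x)"
  using assms(2,3)
proof (induction k arbitrary: f g)
  case 0
  then show ?case by (auto intro: continuous_on_mult)
next
  case (Suc k)
  have fg: "Ck_on k S f" "Ck_on k S g"
    using Suc.prems by (blast intro: Ck_on_Suc_imp_Ck_on)+
  have "Ck_on k S (\<lambda>x. frechet_derivative (\<lambda>x. f x * g x) (at x) v)" for v
    by (rule Ck_on_cong[OF \<open>open S\<close> _ Ck_on_add[OF \<open>open S\<close>
            Suc.IH[of f "\<lambda>x. frechet_derivative g (at x) v"]
            Suc.IH[of "\<lambda>x. frechet_derivative f (at x) v" g]]])
      (use Suc.prems fg in \<open>auto simp: frechet_derivative_real_mult\<close>)
  then show ?case using Suc.prems by auto
qed

lemma smooth_functions_const: "(\<lambda>x. a) \<in> smooth_functions \<A>"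
  by (simp add: smooth_functions_def smooth_on_def o_def Ck_on_const)

lemma smooth_atlas_is_chart: "smooth_atlas \<A> \<Longrightarrow> c \<in> \<A> \<Longrightarrow> is_chart c"
  unfolding smooth_atlas_def by blast

lemma smooth_atlas_cover:
  assumes "smooth_atlas \<A>"
  obtains c where "c \<in> \<A>" "x \<in> chart_dom c"
  using assms unfolding smooth_atlas_def by blast

lemma smooth_functions_Ck_on:
  "F \<in> smooth_functions \<A> \<Longrightarrow> c \<in> \<A> \<Longrightarrow> Ck_on k (chart_codom c) (F \<circ> chart_inv c)"
  unfolding smooth_functions_def smooth_on_def by blast

lemma
  assumes \<A>: "smooth_atlas \<A>" and FG: "F \<in> smooth_functions \<A>" "G \<in> smooth_functions \<A>"
  shows smooth_functions_add: "(\<lambda>x. F x + G x) \<in> smooth_functions \<A>"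
    and smooth_functions_mult: "(\<lambda>x. F x * G x) \<in> smooth_functions \<A>"
proof -
  have S: "open (chart_codom c)" if "c \<in> \<A>" for c
    using smooth_atlas_is_chart[OF \<A> that] unfolding is_chart_def by blast
  note Ck = FG[THEN smooth_functions_Ck_on]
  show "(\<lambda>x. F x + G x) \<in> smooth_functions \<A>"
    unfolding smooth_functions_def smooth_on_def mem_Collect_eq
  proof (intro ballI allI)
    fix c k assume c: "c \<in> \<A>"
    show "Ck_on k (chart_codom c) ((\<lambda>x. F x + G x) \<circ> chart_inv c)"
      using Ck_on_add[OF S[OF c] Ck[OF c]] by (simp add: o_def)
  qed
  show "(\<lambda>x. F x * G x) \<in> smooth_functions \<A>"
    unfolding smooth_functions_def smooth_on_def mem_Collect_eq
  proof (intro ballI allI)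
    fix c k assume c: "c \<in> \<A>"
    show "Ck_on k (chart_codom c) ((\<lambda>x. F x * G x) \<circ> chart_inv c)"
      using Ck_on_mult[OF S[OF c] Ck[OF c]] by (simp add: o_def)
  qed
qed

lemma chart_inv_chart_map:
  assumes "is_chart c" "x \<in> chart_dom c"
  shows "chart_inv c (chart_map c x) = x"
  using assms unfolding is_chart_def homeomorphism_def by auto

lemma chart_map_in_codom: "x \<in> chart_dom c \<Longrightarrow> chart_map c x \<in> chart_codom c"
  by (simp add: chart_codom_def)

lemma smooth_functions_continuous:
  assumes "smooth_atlas \<A>" "F \<in> smooth_functions \<A>"
  shows "continuous_on UNIV F"
proof -
  have "continuous_on (\<Union>c\<in>\<A>. chart_dom c) F"
  proof (rule continuous_on_open_UN)
    fix c assume "c \<in> \<A>"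
    then have c: "is_chart c" and F: "Ck_on 0 (chart_codom c) (F \<circ> chart_inv c)"
      using smooth_atlas_is_chart[OF assms(1)] smooth_functions_Ck_on[OF assms(2)] by blast+
    have "continuous_on (chart_dom c) (chart_map c)"
      using c unfolding is_chart_def homeomorphism_def by blast
    then have "continuous_on (chart_dom c) ((F \<circ> chart_inv c) \<circ> chart_map c)"
      by (rule continuous_on_compose) (use F in \<open>simp add: chart_codom_def\<close>)
    then show "continuous_on (chart_dom c) F"
      by (rule continuous_on_eq) (simp add: chart_inv_chart_map c)
    show "open (chart_dom c)" using c by (simp add: is_chart_def)
  qed
  moreover have "(\<Union>c\<in>\<A>. chart_dom c) = UNIV"
    using assms(1) unfolding smooth_atlas_def by blast
  ultimately show ?thesis by simp
qed

lemma smooth_functions_differentiable: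
  assumes "c \<in> \<A>" "x \<in> chart_dom c" "F \<in> smooth_functions \<A>"
  shows "(F \<circ> chart_inv c) differentiable at (chart_map c x)"
proof -
  have "Ck_on (Suc 0) (chart_codom c) (F \<circ> chart_inv c)"
    using assms by (intro smooth_functions_Ck_on)
  then show ?thesis using chart_map_in_codom[OF assms(2)] by simp
qed


section \<open>Tangent spaces\<close>

lemma coord_vector_linear:
  assumes "c \<in> \<A>" "x \<in> chart_dom c"
  shows "coord_vector \<A> c x (a *\<^sub>R u + b *\<^sub>R v) =
     fscale a (coord_vector \<A> c x u) + fscale b (coord_vector \<A> c x v)"
proof
  fix F
  show "coord_vector \<A> c x (a *\<^sub>R u + b *\<^sub>R v) F =
     (fscale a (coord_vector \<A> c x u) + fscale b (coord_vector \<A> c x v)) F"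
  proof (cases "F \<in> smooth_functions \<A>")
    case True
    then have "linear (frechet_derivative (F \<circ> chart_inv c) (at (chart_map c x)))"
      using assms by (intro linear_frechet_derivative smooth_functions_differentiable)
    then show ?thesis
      using True by (simp add: coord_vector_def fscale_def linear_add linear_scale)
  qed (simp add: coord_vector_def fscale_def)
qed

text \<open>By the chain rule, the coordinates change by the derivative of the transition map.  Hence any one
  chart around \<open>x\<close> yields the whole tangent space, which is therefore a vector space.\<close>

lemma coord_vector_change_chart:
  assumes \<A>: "smooth_atlas \<A>" and c: "c \<in> \<A>" "x \<in> chart_dom c" and d: "d \<in> \<A>" "x \<in> chart_dom d"
  shows "\<exists>w. coord_vector \<A> d x v = coord_vector \<A> c x w"
proof -
  let ?S = "chart_map d ` (chart_dom d \<inter> chart_dom c)"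
  let ?T = "chart_map c \<circ> chart_inv d"
  let ?p = "chart_map d x"
  have cc: "is_chart c" and cd: "is_chart d" using \<A> c d by (blast intro: smooth_atlas_is_chart)+
  have "?S = chart_codom d \<inter> chart_inv d -` chart_dom c"
    using chart_inv_chart_map[OF cd] by (auto simp: chart_codom_def)
  moreover have "open (chart_codom d \<inter> chart_inv d -` chart_dom c)"
    using cc cd by (intro continuous_open_preimage) (auto simp: is_chart_def homeomorphism_def)
  ultimately have "open ?S" by simp
  have pS: "?p \<in> ?S" using c d by auto
  have "Ck_on (Suc 0) ?S ?T"
    using \<A> c d unfolding smooth_atlas_def smooth_on_def by blast
  then have T: "?T differentiable at ?p" using pS unfolding Ck_on.simps(2) by blast
  have Tp: "?T ?p = chart_map c x" using chart_inv_chart_map[OF cd d(2)] by simp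
  have "coord_vector \<A> d x v F = coord_vector \<A> c x (frechet_derivative ?T (at ?p) v) F" for F
  proof (cases "F \<in> smooth_functions \<A>")
    case True
    have "frechet_derivative (F \<circ> chart_inv d) (at ?p)
        = frechet_derivative ((F \<circ> chart_inv c) \<circ> ?T) (at ?p)"
      using \<open>open ?S\<close> pS
      by (rule frechet_derivative_cong_open)
        (auto simp: chart_inv_chart_map cc cd)
    also have "\<dots> = frechet_derivative (F \<circ> chart_inv c) (at (?T ?p)) \<circ> frechet_derivative ?T (at ?p)"
      using T smooth_functions_differentiable[OF c True] Tp
      by (intro frechet_derivative_compose) simp_all
    finally show ?thesis using True Tp by (simp add: coord_vector_def)
  qed (simp add: coord_vector_def)
  then show ?thesis by blast
qed

lemma tangent_space_eq_range:
  assumes "smooth_atlas \<A>" "c \<in> \<A>" "x \<in> chart_dom c"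
  shows "tangent_space \<A> x = range (coord_vector \<A> c x)"
proof
  show "tangent_space \<A> x \<subseteq> range (coord_vector \<A> c x)"
  proof
    fix X assume "X \<in> tangent_space \<A> x"
    then obtain d v where d: "d \<in> \<A>" "x \<in> chart_dom d" and X: "X = coord_vector \<A> d x v"
      unfolding tangent_space_def by blast
    obtain w where "coord_vector \<A> d x v = coord_vector \<A> c x w"
      using coord_vector_change_chart[OF assms d] by blast
    then show "X \<in> range (coord_vector \<A> c x)" using X by blast
  qed
  show "range (coord_vector \<A> c x) \<subseteq> tangent_space \<A> x"
    using assms(2,3) unfolding tangent_space_def by blast
qed

lemma tangent_space_linear:
  assumes "smooth_atlas \<A>" "X \<in> tangent_space \<A> x" "Y \<in> tangent_space \<A> x"
  shows "fscale a X + fscale b Y \<in> tangent_space \<A> x"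
proof -
  obtain c where c: "c \<in> \<A>" "x \<in> chart_dom c"
    using assms(2) by (auto simp: tangent_space_def)
  show ?thesis
    using assms coord_vector_linear[OF c]
    by (auto simp: tangent_space_eq_range[OF assms(1) c] simp flip: coord_vector_linear[OF c])
qed

lemma
  assumes X: "X \<in> tangent_space \<A> x" and \<A>: "smooth_atlas \<A>"
    and FG: "F \<in> smooth_functions \<A>" "G \<in> smooth_functions \<A>"
  shows tangent_vector_add: "X (\<lambda>y. F y + G y) = X F + X G"
    and tangent_vector_mult: "X (\<lambda>y. F y * G y) = F x * X G + X F * G x"
proof -
  obtain c v where c: "c \<in> \<A>" "x \<in> chart_dom c" and X: "X = coord_vector \<A> c x v"
    using X by (auto simp: tangent_space_def)
  have x: "chart_inv c (chart_map c x) = x"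
    using \<A> c by (intro chart_inv_chart_map smooth_atlas_is_chart)
  note diff = FG[THEN smooth_functions_differentiable[OF c], unfolded o_def]
  show "X (\<lambda>y. F y + G y) = X F + X G"
    using diff FG smooth_functions_add[OF \<A> FG]
    by (simp add: X coord_vector_def o_def frechet_derivative_add)
  show "X (\<lambda>y. F y * G y) = F x * X G + X F * G x"
    using diff FG smooth_functions_mult[OF \<A> FG]
    by (simp add: X coord_vector_def o_def frechet_derivative_real_mult x)
qed

lemma tangent_vector_const:
  assumes "X \<in> tangent_space \<A> x"
  shows "X (\<lambda>y. a) = 0"
  using assms by (auto simp: tangent_space_def coord_vector_def o_def)


section \<open>Hamiltonian vector fields and the Poisson bracket\<close>

text \<open>By induction on \<open>B\<close>: unless \<open>f c\<close> is redundant, some \<open>z\<close> killed by the other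
  functionals has \<open>f c z \<noteq> 0\<close>.  Subtracting the multiple of \<open>f c\<close> that agrees with \<open>g\<close> at \<open>z\<close>
  reduces \<open>g\<close> to the remaining functionals.\<close>

lemma functional_in_span_if_common_kernel:
  fixes f :: "'i \<Rightarrow> 'e::real_vector \<Rightarrow> real"
  assumes "finite B" "\<And>b. b \<in> B \<Longrightarrow> linear (f b)" "linear g"
    and "\<And>v. (\<And>b. b \<in> B \<Longrightarrow> f b v = 0) \<Longrightarrow> g v = 0"
  shows "\<exists>a. \<forall>v. g v = (\<Sum>b\<in>B. a b * f b v)"
  using assms
proof (induction B arbitrary: g rule: finite_induct)
  case empty
  then show ?case by auto
next
  case (insert c B)
  note lin = insert.prems(1)[THEN linear_diff] insert.prems(1)[THEN linear_scale]
    linear_diff[OF insert.prems(2)] linear_scale[OF insert.prems(2)]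
  show ?case
  proof (cases "\<forall>v. (\<forall>b\<in>B. f b v = 0) \<longrightarrow> f c v = 0")
    case True
    then obtain a where "\<forall>v. g v = (\<Sum>b\<in>B. a b * f b v)"
      using insert.IH[of g] insert.prems by blast
    then have "\<forall>v. g v = (\<Sum>b\<in>insert c B. (a(c := 0)) b * f b v)"
      using insert.hyps by (auto intro!: sum.cong)
    then show ?thesis by blast
  next
    case False
    then obtain z where z: "\<And>b. b \<in> B \<Longrightarrow> f b z = 0" and cz: "f c z \<noteq> 0" by blast
    define t where "t = g z / f c z"
    have "g v - t * f c v = 0" if v: "\<And>b. b \<in> B \<Longrightarrow> f b v = 0" for v
    proof -
      \<comment> \<open>the projection of \<open>v\<close> along \<open>z\<close> onto the kernel of \<open>f c\<close>\<close>
      let ?w = "v - (f c v / f c z) *\<^sub>R z"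
      have "f b ?w = 0" if "b \<in> insert c B" for b
        using that v z cz by (auto simp: lin)
      then have "g ?w = 0" by (rule insert.prems(3))
      then show ?thesis by (simp add: lin t_def)
    qed
    moreover have "linear (\<lambda>v. g v - t * f c v)"
      using insert.prems(1)[of c] insert.prems(2)
      by (auto simp: linear_iff algebra_simps)
    ultimately obtain a where "\<forall>v. g v - t * f c v = (\<Sum>b\<in>B. a b * f b v)"
      using insert.IH[of "\<lambda>v. g v - t * f c v"] insert.prems(1) by blast
    then have "g v = t * f c v + (\<Sum>b\<in>B. a b * f b v)" for v
      by (metis add.commute diff_add_cancel)
    moreover have "(\<Sum>b\<in>B. a b * f b v) = (\<Sum>b\<in>B. (a(c := t)) b * f b v)" for v
      using insert.hyps by (intro sum.cong) auto
    ultimately have "\<forall>v. g v = (\<Sum>b\<in>insert c B. (a(c := t)) b * f b v)"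
      using insert.hyps by auto
    then show ?thesis by blast
  qed
qed

text \<open>Coordinates in one chart pull \<open>\<omega> x\<close> back to a bilinear form \<open>f\<close> on the model space, spanned by a
  finite set \<open>B\<close>.  A vector killed by all \<open>f b\<close> represents zero, by nondegeneracy, so the
  functional \<open>-dF\<close> kills it too and is a linear combination of the \<open>f b\<close>; the same combination of
  the vectors \<open>b\<close> represents the required vector.  Comparing kernels instead
  of dimensions avoids the smooth cutoff functions that show different coordinates to represent
  different derivations of globally smooth functions.\<close>

lemma hamiltonian_vector_exists:
  fixes \<A> :: "('m::{t2_space,second_countable_topology}, 'e::real_normed_vector) chart set"
  assumes M: "closed_symplectic_manifold \<A> \<omega>" and F: "F \<in> smooth_functions \<A>"
  shows "\<exists>X\<in>tangent_space \<A> x. \<forall>Y\<in>tangent_space \<A> x. \<omega> x X Y = - Y F"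
proof -
  have \<A>: "smooth_atlas \<A>" and \<omega>: "differential_2form \<A> \<omega>" "nondegenerate_2form \<A> \<omega>"
    using M unfolding closed_symplectic_manifold_def closed_manifold_def by blast+
  obtain B :: "'e set" where B: "finite B" "span B = UNIV"
    using M unfolding closed_symplectic_manifold_def closed_manifold_def by blast
  obtain c where c: "c \<in> \<A>" "x \<in> chart_dom c"
    using \<A> by (rule smooth_atlas_cover)
  note T = tangent_space_eq_range[OF \<A> c]
  define cv where "cv = coord_vector \<A> c x"
  define f where "f u v = \<omega> x (cv u) (cv v)" for u v
  have cv: "cv v \<in> tangent_space \<A> x" for v by (simp add: cv_def T)
  have cv_lin: "cv (a *\<^sub>R u + b *\<^sub>R v) = fscale a (cv u) + fscale b (cv v)" for a b u v
    unfolding cv_def by (rule coord_vector_linear[OF c])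
  have anti: "f u v = - f v u" for u v
    using \<omega>(1) cv unfolding differential_2form_def f_def by blast
  have left: "f (a *\<^sub>R u + b *\<^sub>R v) w = a * f u w + b * f v w" for a b u v w
    using \<omega>(1) cv unfolding differential_2form_def f_def cv_lin by blast
  have right: "f w (a *\<^sub>R u + b *\<^sub>R v) = a * f w u + b * f w v" for a b u v w
  proof -
    have "f w (a *\<^sub>R u + b *\<^sub>R v) = - f (a *\<^sub>R u + b *\<^sub>R v) w" by (rule anti)
    also have "\<dots> = a * (- f u w) + b * (- f v w)" by (simp add: left)
    finally show ?thesis by (simp only: anti[symmetric])
  qed
  have linl: "linear (\<lambda>u. f u v)" for v
    using left[of 1 _ 1 _ v] left[of _ _ 0 _ v] by (intro linearI) simp_all
  have linr: "linear (f v)" for v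
    using right[of v 1 _ 1] right[of v _ _ 0] by (intro linearI) simp_all
  have "linear (\<lambda>v. - cv v F)"
    using cv_lin[of 1 _ 1] cv_lin[of _ _ 0] by (intro linearI) (simp_all add: fscale_def)
  moreover have "- cv v F = 0" if v: "\<And>b. b \<in> B \<Longrightarrow> f b v = 0" for v
  proof -
    have "f u v = 0" for u
      using linear_eq_0_on_span[OF linl, of B v u] v B by auto
    then have "f v u = 0" for u using anti[of v u] by simp
    then have "\<forall>Y\<in>tangent_space \<A> x. \<omega> x (cv v) Y = 0"
      by (auto simp: T f_def cv_def)
    then have "cv v = 0" using \<omega>(2) cv unfolding nondegenerate_2form_def by blast
    then show ?thesis by simp
  qed
  ultimately obtain a where a: "\<And>v. - cv v F = (\<Sum>b\<in>B. a b * f b v)"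
    using functional_in_span_if_common_kernel[of B f "\<lambda>v. - cv v F"] B linr by blast
  have "(\<Sum>b\<in>B. a b * f b v) = f (\<Sum>b\<in>B. a b *\<^sub>R b) v" for v
    using linear_sum[OF linl, of "\<lambda>b. a b *\<^sub>R b" B v] linear_scale[OF linl] by simp
  then have "\<forall>Y\<in>tangent_space \<A> x. \<omega> x (cv (\<Sum>b\<in>B. a b *\<^sub>R b)) Y = - Y F"
    using a by (auto simp: T f_def cv_def)
  then show ?thesis using cv by blast
qed

lemma
  fixes \<A> :: "('m::{t2_space,second_countable_topology}, 'e::real_normed_vector) chart set"
  assumes M: "closed_symplectic_manifold \<A> \<omega>" and F: "F \<in> smooth_functions \<A>"
  shows ham_vector_field_tangent: "ham_vector_field \<A> \<omega> F x \<in> tangent_space \<A> x"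
    and form_ham_vector_field:
      "Y \<in> tangent_space \<A> x \<Longrightarrow> \<omega> x (ham_vector_field \<A> \<omega> F x) Y = - Y F"
proof -
  have \<A>: "smooth_atlas \<A>" and \<omega>: "differential_2form \<A> \<omega>" "nondegenerate_2form \<A> \<omega>"
    using M unfolding closed_symplectic_manifold_def closed_manifold_def by blast+
  \<comment> \<open>the defining property under the definite description\<close>
  let ?P = "\<lambda>X. X \<in> tangent_space \<A> x \<and> (\<forall>Y\<in>tangent_space \<A> x. \<omega> x X Y = - Y F)"
  have "X = X'" if X: "?P X" and X': "?P X'" for X X'
  proof -
    let ?D = "fscale 1 X + fscale (-1) X'"
    have "?D \<in> tangent_space \<A> x" using tangent_space_linear[OF \<A>] X X' by blast
    moreover have "\<omega> x ?D Y = 0" if Y: "Y \<in> tangent_space \<A> x" for Y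
    proof -
      have "\<omega> x ?D Y = 1 * \<omega> x X Y + (-1) * \<omega> x X' Y"
        using \<omega>(1) X X' Y unfolding differential_2form_def by blast
      then show ?thesis using X X' Y by simp
    qed
    ultimately have "?D = 0" using \<omega>(2) unfolding nondegenerate_2form_def by blast
    then show ?thesis by (auto simp: fscale_def fun_eq_iff)
  qed
  then have "\<exists>!X. ?P X" using hamiltonian_vector_exists[OF M F, of x] by blast
  then have "?P (ham_vector_field \<A> \<omega> F x)"
    unfolding ham_vector_field_def by (rule theI')
  then show "ham_vector_field \<A> \<omega> F x \<in> tangent_space \<A> x"
    and "Y \<in> tangent_space \<A> x \<Longrightarrow> \<omega> x (ham_vector_field \<A> \<omega> F x) Y = - Y F"
    by blast+
qed

lemma
  fixes \<A> :: "('m::{t2_space,second_countable_topology}, 'e::real_normed_vector) chart set"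
  assumes M: "closed_symplectic_manifold \<A> \<omega>"
    and F: "F \<in> smooth_functions \<A>" and G: "G \<in> smooth_functions \<A>"
  shows poisson_bracket_eq_derivative:
      "poisson_bracket \<A> \<omega> F G x = - ham_vector_field \<A> \<omega> F x G"
    and poisson_bracket_commute: "poisson_bracket \<A> \<omega> F G x = - poisson_bracket \<A> \<omega> G F x"
proof -
  note XF = ham_vector_field_tangent[OF M F, of x] and XG = ham_vector_field_tangent[OF M G, of x]
  show "poisson_bracket \<A> \<omega> F G x = - ham_vector_field \<A> \<omega> F x G"
    unfolding poisson_bracket_def by (rule form_ham_vector_field[OF M G XF])
  have "differential_2form \<A> \<omega>"
    using M by (simp add: closed_symplectic_manifold_def)
  then show "poisson_bracket \<A> \<omega> F G x = - poisson_bracket \<A> \<omega> G F x"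
    unfolding poisson_bracket_def differential_2form_def using XF XG by blast
qed


section \<open>The algebra generated by a Poisson-commutative family\<close>

inductive_set generated_algebra :: "('m \<Rightarrow> real) set \<Rightarrow> ('m \<Rightarrow> real) set"
  for A where
  gen: "F \<in> A \<Longrightarrow> F \<in> generated_algebra A"
| const: "(\<lambda>x. a) \<in> generated_algebra A"
| add: "F \<in> generated_algebra A \<Longrightarrow> G \<in> generated_algebra A \<Longrightarrow>
    (\<lambda>x. F x + G x) \<in> generated_algebra A"
| mult: "F \<in> generated_algebra A \<Longrightarrow> G \<in> generated_algebra A \<Longrightarrow>
    (\<lambda>x. F x * G x) \<in> generated_algebra A"

lemma generated_algebra_sum:
  assumes "\<And>i. i \<in> I \<Longrightarrow> f i \<in> generated_algebra A"
  shows "(\<lambda>x. \<Sum>i\<in>I. f i x) \<in> generated_algebra A"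
  using assms
  by (induction I rule: infinite_finite_induct)
    (auto intro: generated_algebra.intros)

lemma generated_algebra_polynomial:
  assumes "real_polynomial_function p" "D \<in> generated_algebra A"
  shows "(\<lambda>x. p (D x :: real)) \<in> generated_algebra A"
  using assms(1)
proof induction
  case (linear f)
  then have "f t = t * f 1" for t
    using linear_scale[OF bounded_linear.linear, of f t 1] by simp
  then have "(\<lambda>x. f (D x)) = (\<lambda>x. D x * f 1)" by blast
  then show ?case using assms(2) by (simp add: generated_algebra.intros)
qed (auto intro: generated_algebra.intros)

lemma generated_algebra_smooth:
  assumes "smooth_atlas \<A>" "A \<subseteq> smooth_functions \<A>" "F \<in> generated_algebra A"
  shows "F \<in> smooth_functions \<A>"
  using assms(3) assms(1,2)
  by induction (auto intro: smooth_functions_const smooth_functions_add smooth_functions_mult)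

text \<open>The functions commuting with \<open>F\<close> are those annihilated by the derivation \<open>X\<^sub>F\<close>, so they form an
  algebra.\<close>

lemma generated_algebra_centralizer:
  fixes \<A> :: "('m::{t2_space,second_countable_topology}, 'e::real_normed_vector) chart set"
  assumes M: "closed_symplectic_manifold \<A> \<omega>" and A: "A \<subseteq> smooth_functions \<A>"
    and F: "F \<in> smooth_functions \<A>"
    and comm: "\<And>G. G \<in> A \<Longrightarrow> poisson_bracket \<A> \<omega> F G x = 0"
    and G: "G \<in> generated_algebra A"
  shows "poisson_bracket \<A> \<omega> F G x = 0"
proof -
  have \<A>: "smooth_atlas \<A>"
    using M unfolding closed_symplectic_manifold_def closed_manifold_def by blast
  note sm = generated_algebra_smooth[OF \<A> A]
  note X = ham_vector_field_tangent[OF M F, of x]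
  have "ham_vector_field \<A> \<omega> F x G = 0"
    using G
  proof induction
    case (gen G)
    then show ?case using comm[OF gen] poisson_bracket_eq_derivative[OF M F, of G x] A by auto
  next
    case (const a)
    show ?case by (rule tangent_vector_const[OF X])
  next
    case (add G1 G2)
    then show ?case by (simp add: tangent_vector_add[OF X \<A>] sm)
  next
    case (mult G1 G2)
    then show ?case by (simp add: tangent_vector_mult[OF X \<A>] sm)
  qed
  then show ?thesis by (simp add: poisson_bracket_eq_derivative[OF M F] sm[OF G])
qed

text \<open>The centralizer lemma applies twice: elements of \<open>A\<close> commute with the whole algebra, hence by
  antisymmetry every element of the algebra commutes with \<open>A\<close>, and so with the algebra.\<close>

lemma generated_algebra_poisson_commutative:
  fixes \<A> :: "('m::{t2_space,second_countable_topology}, 'e::real_normed_vector) chart set"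
  assumes M: "closed_symplectic_manifold \<A> \<omega>" and A: "A \<subseteq> smooth_functions \<A>"
    and comm: "poisson_commutative \<A> \<omega> A"
  shows "poisson_commutative \<A> \<omega> (generated_algebra A)"
  unfolding poisson_commutative_def
proof (intro ballI allI)
  fix F G x assume F: "F \<in> generated_algebra A" and G: "G \<in> generated_algebra A"
  have "smooth_atlas \<A>"
    using M unfolding closed_symplectic_manifold_def closed_manifold_def by blast
  note sm = generated_algebra_smooth[OF this A]
  have "poisson_bracket \<A> \<omega> F K x = 0" if K: "K \<in> A" for K
  proof -
    have K': "K \<in> smooth_functions \<A>" using K A by blast
    have "poisson_bracket \<A> \<omega> K F x = 0"
      using comm K by (intro generated_algebra_centralizer[OF M A K' _ F])
        (auto simp: poisson_commutative_def)
    then show ?thesis using poisson_bracket_commute[OF M sm[OF F] K'] by simp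
  qed
  then show "poisson_bracket \<A> \<omega> F G x = 0"
    by (rule generated_algebra_centralizer[OF M A sm[OF F] _ G])
qed


section \<open>Quasi-states on uniform limits\<close>

definition uniform_closure :: "('m::topological_space \<Rightarrow> real) set \<Rightarrow> ('m \<Rightarrow> real) set" where
  "uniform_closure P = {h \<in> cont_functions. \<forall>e>0. \<exists>p\<in>P. \<forall>x. \<bar>h x - p x\<bar> < e}"

lemma uniform_closure_generated_algebra_add:
  assumes "f \<in> uniform_closure (generated_algebra A)" "g \<in> uniform_closure (generated_algebra A)"
  shows "(\<lambda>x. f x + g x) \<in> uniform_closure (generated_algebra A)"
proof -
  have "\<exists>r\<in>generated_algebra A. \<forall>x. \<bar>f x + g x - r x\<bar> < e" if "e > 0" for e
  proof -
    have "e / 2 > 0" using that by simp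
    then obtain p q where pq: "p \<in> generated_algebra A" "q \<in> generated_algebra A"
      "\<And>x. \<bar>f x - p x\<bar> < e / 2" "\<And>x. \<bar>g x - q x\<bar> < e / 2"
      using assms unfolding uniform_closure_def by blast
    have "\<bar>f x + g x - (p x + q x)\<bar> < e" for x
      using pq(3,4)[of x] by linarith
    then show ?thesis
      by (intro bexI[of _ "\<lambda>x. p x + q x"]) (auto intro: generated_algebra.add pq)
  qed
  then show ?thesis using assms
    by (auto simp: uniform_closure_def cont_functions_def intro: continuous_on_add)
qed

lemma quasi_state_monotone:
  assumes "compact (UNIV :: 'm::topological_space set)"
    and "partial_symplectic_quasi_state \<A> \<omega> \<zeta>"
    and FG: "F \<in> cont_functions" "G \<in> cont_functions" and le: "\<And>x::'m. F x \<le> G x + a"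
  shows "\<zeta> F \<le> \<zeta> G + a"
proof -
  have "\<zeta> F - \<zeta> G \<le> (SUP x. F x - G x)"
    using assms(2) FG unfolding partial_symplectic_quasi_state_def by blast
  also have "\<dots> \<le> a"
    using le by (intro cSUP_least) (auto simp: algebra_simps)
  finally show ?thesis by simp
qed

text \<open>Replacing \<open>f\<close> and \<open>g\<close> by smooth commuting functions at distance less than \<open>e / 4\<close> moves
  the left-hand side by at most \<open>e / 2\<close> and each term on the right by at most \<open>e / 4\<close>.\<close>

lemma quasi_state_subadditive_uniform_closure:
  fixes \<A> :: "('m::{t2_space,second_countable_topology}, 'e::real_normed_vector) chart set"
  assumes M: "closed_symplectic_manifold \<A> \<omega>" and A: "A \<subseteq> smooth_functions \<A>"
    and comm: "poisson_commutative \<A> \<omega> A"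
    and \<zeta>: "partial_symplectic_quasi_state \<A> \<omega> \<zeta>"
    and fg: "f \<in> uniform_closure (generated_algebra A)" "g \<in> uniform_closure (generated_algebra A)"
  shows "\<zeta> (\<lambda>x. f x + g x) \<le> \<zeta> f + \<zeta> g"
proof (rule field_le_epsilon)
  fix e :: real assume "e > 0"
  then have "e / 4 > 0" by simp
  then obtain p q where pq: "p \<in> generated_algebra A" "q \<in> generated_algebra A"
      and p: "\<And>x. \<bar>f x - p x\<bar> < e / 4" and q: "\<And>x. \<bar>g x - q x\<bar> < e / 4"
    using fg unfolding uniform_closure_def by blast
  have \<A>: "smooth_atlas \<A>" and cpt: "compact (UNIV :: 'm set)"
    using M unfolding closed_symplectic_manifold_def closed_manifold_def by blast+
  note sm = pq[THEN generated_algebra_smooth[OF \<A> A]]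
  have cont: "p \<in> cont_functions" "q \<in> cont_functions" "f \<in> cont_functions" "g \<in> cont_functions"
    using sm[THEN smooth_functions_continuous[OF \<A>]] fg
    by (auto simp: cont_functions_def uniform_closure_def)
  then have cont2: "(\<lambda>x. f x + g x) \<in> cont_functions" "(\<lambda>x. p x + q x) \<in> cont_functions"
    by (auto simp: cont_functions_def intro: continuous_on_add)
  note mono = quasi_state_monotone[OF cpt \<zeta>]
  have "\<zeta> (\<lambda>x. f x + g x) \<le> \<zeta> (\<lambda>x. p x + q x) + e / 2"
  proof (rule mono[OF cont2])
    show "f x + g x \<le> p x + q x + e / 2" for x using p[of x] q[of x] by linarith
  qed
  moreover have "\<zeta> (\<lambda>x. p x + q x) \<le> \<zeta> p + \<zeta> q"
    using \<zeta> sm generated_algebra_poisson_commutative[OF M A comm] pq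
    unfolding partial_symplectic_quasi_state_def poisson_commutative_def by blast
  moreover have "\<zeta> p \<le> \<zeta> f + e / 4"
  proof (rule mono[OF cont(1,3)])
    show "p x \<le> f x + e / 4" for x using p[of x] by linarith
  qed
  moreover have "\<zeta> q \<le> \<zeta> g + e / 4"
  proof (rule mono[OF cont(2,4)])
    show "q x \<le> g x + e / 4" for x using q[of x] by linarith
  qed
  ultimately show "\<zeta> (\<lambda>x. f x + g x) \<le> \<zeta> f + \<zeta> g + e" by linarith
qed

lemma quasi_state_sum_nonpos:
  fixes \<A> :: "('m::{t2_space,second_countable_topology}, 'e::real_normed_vector) chart set"
  assumes M: "closed_symplectic_manifold \<A> \<omega>" and A: "A \<subseteq> smooth_functions \<A>"
    and comm: "poisson_commutative \<A> \<omega> A"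
    and \<zeta>: "partial_symplectic_quasi_state \<A> \<omega> \<zeta>"
    and "finite I"
    and "\<And>i. i \<in> I \<Longrightarrow> f i \<in> uniform_closure (generated_algebra A)"
    and "\<And>i. i \<in> I \<Longrightarrow> \<zeta> (f i) \<le> 0"
  shows "\<zeta> (\<lambda>x. \<Sum>i\<in>I. f i x) \<le> 0"
proof -
  have "(\<lambda>x. \<Sum>i\<in>I. f i x) \<in> uniform_closure (generated_algebra A) \<and> \<zeta> (\<lambda>x. \<Sum>i\<in>I. f i x) \<le> 0"
    using assms(5-)
  proof (induction I rule: finite_induct)
    case empty
    have "\<zeta> (\<lambda>x. 0) = 0"
      using \<zeta> by (auto simp: partial_symplectic_quasi_state_def)
    moreover have "(\<lambda>x. 0) \<in> uniform_closure (generated_algebra A)"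
      using generated_algebra.const[of 0 A]
      by (force simp: uniform_closure_def cont_functions_def)
    ultimately show ?case by simp
  next
    case (insert i I)
    let ?s = "\<lambda>x. \<Sum>j\<in>I. f j x"
    have f: "f i \<in> uniform_closure (generated_algebra A)" "\<zeta> (f i) \<le> 0"
      and s: "?s \<in> uniform_closure (generated_algebra A)" "\<zeta> ?s \<le> 0"
      using insert by auto
    have "\<zeta> (\<lambda>x. f i x + ?s x) \<le> \<zeta> (f i) + \<zeta> ?s"
      by (rule quasi_state_subadditive_uniform_closure[OF M A comm \<zeta> f(1) s(1)])
    then show ?case
      using insert.hyps f s uniform_closure_generated_algebra_add[OF f(1) s(1)] by simp
  qed
  then show ?thesis ..
qed


section \<open>Bump functions around fibres of the moment map\<close>

lemma moment_map_eq_iff: "moment_map A z = moment_map A x \<longleftrightarrow> (\<forall>F\<in>A. F z = F x)"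
  by (auto simp: moment_map_def fun_eq_iff restrict_def)

text \<open>The fibre through \<open>x\<close> is the zero set of \<open>D = (\<Sum>F. (F - F x)\<^sup>2)\<close>, where \<open>F\<close> runs through a finite
  spanning set of \<open>A\<close>.  By compactness \<open>D\<close> exceeds some \<open>e > 0\<close> off \<open>U\<close>, so \<open>max 0 (e - D)\<close> is
  supported in \<open>U\<close>.  A polynomial \<open>p\<close> close to \<open>max 0 (e - t)\<close> on the compact range of \<open>D\<close>
  gives the approximation \<open>p \<circ> D\<close>, which lies in the generated algebra.\<close>

lemma fibre_bump:
  fixes \<A> :: "('m::{t2_space,second_countable_topology}, 'e::real_normed_vector) chart set"
  assumes \<A>: "closed_manifold \<A>" and A: "A \<subseteq> smooth_functions \<A>"
    and fd: "finite_dim_subspace A"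
    and U: "open U" "moment_map A -` {moment_map A x} \<subseteq> U"
  obtains \<rho> where "\<rho> \<in> uniform_closure (generated_algebra A)" "fsupport \<rho> \<subseteq> U"
    "\<rho> x > 0" "\<And>z. \<rho> z \<ge> 0"
proof -
  have at: "smooth_atlas \<A>" and cpt: "compact (UNIV :: 'm set)"
    using \<A> unfolding closed_manifold_def by blast+
  obtain B where B: "finite B" "fun_vs.span B = A"
    using fd by (auto simp: finite_dim_subspace_def)
  define D where "D z = (\<Sum>F\<in>B. (F z - F x) * (F z - F x))" for z
  have "(\<lambda>z. F z - F x) \<in> generated_algebra A" if "F \<in> B" for F
    using that B fun_vs.span_base[of F B]
      generated_algebra.add[OF generated_algebra.gen[of F A] generated_algebra.const[of "- F x"]]
    by auto
  then have "D \<in> generated_algebra A"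
    unfolding D_def by (intro generated_algebra_sum generated_algebra.mult)
  then have D: "continuous_on UNIV D"
    by (intro smooth_functions_continuous[OF at] generated_algebra_smooth[OF at A])
  have D_pos: "D z > 0" if "z \<notin> U" for z
  proof (rule ccontr)
    assume "\<not> D z > 0"
    moreover have "D z \<ge> 0" unfolding D_def by (intro sum_nonneg) simp
    ultimately have "D z = 0" by simp
    then have zB: "F z = F x" if "F \<in> B" for F
      using B(1) that unfolding D_def by (subst (asm) sum_nonneg_eq_0_iff) auto
    have "fun_vs.subspace {F. F z = F x}"
      by (auto simp: fun_vs.subspace_def fscale_def)
    then have "F z = F x" if "F \<in> A" for F
      using fun_vs.span_minimal[of B "{F. F z = F x}"] zB B(2) that by auto
    then have "moment_map A z = moment_map A x" unfolding moment_map_eq_iff by blast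
    then show False using U(2) \<open>z \<notin> U\<close> by blast
  qed
  have "compact (- U)" using compact_Int_closed[OF cpt, of "- U"] U(1) by (simp add: closed_Compl)
  have "\<exists>e>0. \<forall>z. z \<notin> U \<longrightarrow> e < D z"
  proof (cases "- U = {}")
    case False
    then obtain y where "y \<in> - U" "\<And>z. z \<in> - U \<Longrightarrow> D y \<le> D z"
      using continuous_attains_inf[OF \<open>compact (- U)\<close> _ continuous_on_subset[OF D]] by auto
    then show ?thesis using D_pos[of y] by (intro exI[of _ "D y / 2"]) force
  qed (auto intro: exI[of _ 1])
  then obtain e where e: "e > 0" "\<And>z. z \<notin> U \<Longrightarrow> e < D z" by blast
  define \<rho> where "\<rho> z = max 0 (e - D z)" for z
  have "\<exists>p\<in>generated_algebra A. \<forall>z. \<bar>\<rho> z - p z\<bar> < d" if "d > 0" for d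
  proof -
    have "compact (range D)" using D cpt by (rule compact_continuous_image)
    moreover have "continuous_on (range D) (\<lambda>t. max 0 (e - t))" by (intro continuous_intros)
    ultimately obtain p where p: "real_polynomial_function p"
      "\<And>t. t \<in> range D \<Longrightarrow> \<bar>max 0 (e - t) - p t\<bar> < d"
      using Stone_Weierstrass_real_polynomial_function[of "range D" "\<lambda>t. max 0 (e - t)" d] \<open>d > 0\<close>
      by blast
    then show ?thesis
      using generated_algebra_polynomial[OF p(1) \<open>D \<in> generated_algebra A\<close>]
      by (intro bexI[of _ "\<lambda>z. p (D z)"]) (auto simp: \<rho>_def)
  qed
  moreover have "\<rho> \<in> cont_functions"
    unfolding cont_functions_def \<rho>_def using D by (auto intro!: continuous_intros)
  ultimately have "\<rho> \<in> uniform_closure (generated_algebra A)"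
    by (simp add: uniform_closure_def)
  moreover have "fsupport \<rho> \<subseteq> {z. D z \<le> e}"
    unfolding fsupport_def using D
    by (intro closure_minimal closed_Collect_le) (auto simp: \<rho>_def intro: continuous_intros)
  then have "fsupport \<rho> \<subseteq> U" using e(2) by force
  moreover have "\<rho> x > 0" using e(1) by (simp add: \<rho>_def D_def)
  ultimately show ?thesis using that[of \<rho>] by (simp add: \<rho>_def)
qed


section \<open>Existence of a pseudoheavy fibre\<close>

theorem theorem1p7:
  fixes \<A> :: "('m::{t2_space,second_countable_topology}, 'e::real_normed_vector) chart set"
    and \<omega> :: "'m form2"
    and A :: "('m \<Rightarrow> real) set"
    and \<zeta> :: "('m \<Rightarrow> real) \<Rightarrow> real"
  assumes "closed_symplectic_manifold \<A> \<omega>"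
    and "finite_dim_subspace A"
    and "A \<subseteq> smooth_functions \<A>"
    and "poisson_commutative \<A> \<omega> A"
    and "partial_symplectic_quasi_state \<A> \<omega> \<zeta>"
  shows "\<exists>y0 \<in> range (moment_map A). pseudoheavy \<zeta> (moment_map A -` {y0})"
proof (rule ccontr)
  assume "\<not> ?thesis"
  then have no: "\<not> pseudoheavy \<zeta> (moment_map A -` {moment_map A x})" for x by blast
  have \<A>: "closed_manifold \<A>" "smooth_atlas \<A>" and cpt: "compact (UNIV :: 'm set)"
    using assms(1) unfolding closed_symplectic_manifold_def closed_manifold_def by blast+
  have "\<exists>\<rho>. \<rho> \<in> uniform_closure (generated_algebra A) \<and> \<rho> x > 0 \<and> (\<forall>z. \<rho> z \<ge> 0) \<and> \<zeta> \<rho> \<le> 0" for x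
  proof -
    have "moment_map A -` {moment_map A x} = (\<Inter>F\<in>A. {z. F z = F x})"
      by (auto simp: moment_map_eq_iff)
    moreover have "closed (\<Inter>F\<in>A. {z. F z = F x})"
      using assms(3) smooth_functions_continuous[OF \<A>(2)]
      by (intro closed_INT ballI closed_Collect_eq) (auto intro: continuous_intros)
    ultimately obtain U where U: "open U" "moment_map A -` {moment_map A x} \<subseteq> U"
      and neg: "\<And>F. F \<in> functions_supported_in U \<Longrightarrow> \<zeta> F \<le> 0"
      using no[of x] unfolding pseudoheavy_def by force
    obtain \<rho> where \<rho>: "\<rho> \<in> uniform_closure (generated_algebra A)" "fsupport \<rho> \<subseteq> U"
      "\<rho> x > 0" "\<And>z. \<rho> z \<ge> 0"
      using fibre_bump[OF \<A>(1) assms(3,2) U] by blast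
    then have "\<rho> \<in> functions_supported_in U"
      by (auto simp: functions_supported_in_def uniform_closure_def)
    then show ?thesis using neg \<rho> by blast
  qed
  then obtain \<rho> where \<rho>: "\<And>x. \<rho> x \<in> uniform_closure (generated_algebra A)"
    "\<And>x. \<rho> x x > 0" "\<And>x z. \<rho> x z \<ge> 0" "\<And>x. \<zeta> (\<rho> x) \<le> 0"
    by metis
  have cont: "continuous_on UNIV (\<rho> x)" for x
    using \<rho>(1)[of x] by (simp add: uniform_closure_def cont_functions_def)
  have op: "open {z. \<rho> x z > 0}" for x
    using cont by (intro open_Collect_less) auto
  have cover: "UNIV \<subseteq> (\<Union>x\<in>UNIV. {z. \<rho> x z > 0})" using \<rho>(2) by blast
  obtain I where I: "finite I" "UNIV \<subseteq> (\<Union>x\<in>I. {z. \<rho> x z > 0})"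
    by (rule compactE_image[OF cpt op cover])
  define s where "s z = (\<Sum>x\<in>I. \<rho> x z)" for z
  have s: "continuous_on UNIV s"
    unfolding s_def by (intro continuous_on_sum cont)
  have s_pos: "s z > 0" for z
  proof -
    obtain x where "x \<in> I" "\<rho> x z > 0" using I(2) by blast
    then show ?thesis unfolding s_def using I(1) \<rho>(3) by (intro sum_pos2[of I x]) auto
  qed
  obtain y where y: "\<And>z. s y \<le> s z"
    using continuous_attains_inf[OF cpt _ s] by blast
  \<comment> \<open>compare \<open>s\<close> with the constant function equal to its minimum\<close>
  have "\<zeta> (\<lambda>z. s y) \<le> \<zeta> s + 0"
    using y s by (intro quasi_state_monotone[OF cpt assms(5)]) (auto simp: cont_functions_def)
  moreover have "\<zeta> (\<lambda>z. s y) = s y"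
    using assms(5) by (simp add: partial_symplectic_quasi_state_def)
  moreover have "\<zeta> s \<le> 0"
    using quasi_state_sum_nonpos[OF assms(1,3,4,5) I(1), of \<rho>] \<rho>(1,4) by (simp add: s_def[abs_def])
  ultimately show False using s_pos[of y] by linarith
qed

end
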